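(* Let $A,B,S,T$ be finite sets and $\Gamma=A\times B\times S\times T$. If $C_q(\Gamma)$ is not closed (as a subset of $\mathbb{R}^\Gamma$), then there exists a sequence $\{P_i\}_{i\in\mathbb{N}}\subseteq C_q(\Gamma)$ with $A_q(P_i)\to\infty$.
   Context: A (bipartite) correlation is a vector $P=(P(a,b|s,t))\in\mathbb{R}^\Gamma$ with $P(a,b|s,t)\ge 0$ for all $(a,b,s,t)\in\Gamma$ and $\sum_{a,b}P(a,b|s,t)=1$ for all $(s,t)\in S\times T$. For $d\in\mathbb{N}$, $C_q^d(\Gamma)$ is the set of correlations of the form $P(a,b|s,t)=\psi^*(E_s^a\otimes F_t^b)\psi$, where $\psi\in\mathbb{C}^d\otimes\mathbb{C}^d$ is a unit vector and, for all $s\in S$, $t\in T$, $\{E_s^a\}_{a\in A}$ and $\{F_t^b\}_{b\in B}$ are families of $d\times d$ Hermitian positive semidefinite matrices summing to the identity. Set $C_q(\Gamma)=\bigcup_{d\in\mathbb{N}}C_q^d(\Gamma)$ and, for $P\in C_q(\Gamma)$, $D_q(P)=\min\{d^2: d\in\mathbb{N},\ P\in C_q^d(\Gamma)\}$. The minimal average entanglement dimension is $$A_q(P)=\inf\Big\{\sum_{i=1}^I\lambda_iD_q(P_i): I\in\mathbb{N},\ \lambda\in\mathbb{R}_+^I,\ \sum_{i=1}^I\lambda_i=1,\ P=\sum_{i=1}^I\lambda_iP_i,\ P_i\in C_q(\Gamma)\Big\}.$$ *)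

theory Defs
  imports "HOL-Analysis.Analysis" "Jordan_Normal_Form.Schur_Decomposition"
begin

text \<open>
  The finite sets A, B, S, T are the universes of finite types, hence nonempty; if one of them were
  empty, \<open>\<Gamma>\<close> would be empty and every set of correlations closed. A correlation is a point of
  \<open>real ^ ('a \<times> 'b \<times> 's \<times> 't)\<close>, with \<open>vec_nth P (a, b, s, t)\<close> for P(a,b|s,t). Since the
  dimension d is quantified over, operators are matrices of \<open>Jordan_Normal_Form\<close> rather than
  matrices with type-level dimension. There \<open>v \<bullet>c w\<close> is conjugate-linear in \<open>w\<close>, so that
  \<open>(M *\<^sub>v v) \<bullet>c v\<close> is the form \<open>v\<^sup>* M v\<close>.
\<close>

definition correlation :: "real ^ ('a::finite \<times> 'b::finite \<times> 's::finite \<times> 't::finite) \<Rightarrow> bool"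
  where "correlation P \<longleftrightarrow>
    (\<forall>a b s t. 0 \<le> vec_nth P (a, b, s, t)) \<and>
    (\<forall>s t. (\<Sum>a\<in>UNIV. \<Sum>b\<in>UNIV. vec_nth P (a, b, s, t)) = 1)"

text \<open>The order on \<open>complex\<close> below is that of \<open>HOL-Library.Complex_Order\<close>: \<open>0 \<le> z\<close> means that
  \<open>z\<close> is real and nonnegative.\<close>

definition hermitian_psd :: "nat \<Rightarrow> complex mat \<Rightarrow> bool"
  where "hermitian_psd d M \<longleftrightarrow>
    M \<in> carrier_mat d d \<and> mat_adjoint M = M \<and>
    (\<forall>v \<in> carrier_vec d. 0 \<le> (M *\<^sub>v v) \<bullet>c v)"

text \<open>The sum to the identity is stated entrywise because the type of matrices of all dimensions
  is not an additive monoid.\<close>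

definition povm :: "nat \<Rightarrow> ('x::finite \<Rightarrow> complex mat) \<Rightarrow> bool"
  where "povm d E \<longleftrightarrow>
    (\<forall>x. hermitian_psd d (E x)) \<and>
    mat d d (\<lambda>ij. \<Sum>x\<in>UNIV. E x $$ ij) = 1\<^sub>m d"

text \<open>Kronecker product; it identifies \<open>e\<^sub>i \<otimes> e\<^sub>j\<close> with the basis vector of index \<open>i * d + j\<close>,
  and thereby the tensor square of the d-dimensional space with \<open>carrier_vec (d * d)\<close>.\<close>

definition tensor_mat :: "complex mat \<Rightarrow> complex mat \<Rightarrow> complex mat"  (infixl \<open>\<otimes>\<^sub>m\<close> 70)
  where "M \<otimes>\<^sub>m N =
    mat (dim_row M * dim_row N) (dim_col M * dim_col N)
      (\<lambda>(i, j). M $$ (i div dim_row N, j div dim_col N) * N $$ (i mod dim_row N, j mod dim_col N))"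

definition C_q_dim :: "nat \<Rightarrow> (real ^ ('a::finite \<times> 'b::finite \<times> 's::finite \<times> 't::finite)) set"
  where "C_q_dim d = {P. correlation P \<and>
    (\<exists>\<psi> (E :: 's \<Rightarrow> 'a \<Rightarrow> complex mat) (F :: 't \<Rightarrow> 'b \<Rightarrow> complex mat).
      \<psi> \<in> carrier_vec (d * d) \<and> \<psi> \<bullet>c \<psi> = 1 \<and>
      (\<forall>s. povm d (E s)) \<and> (\<forall>t. povm d (F t)) \<and>
      (\<forall>a b s t. complex_of_real (vec_nth P (a, b, s, t)) =
        ((E s a \<otimes>\<^sub>m F t b) *\<^sub>v \<psi>) \<bullet>c \<psi>))}"

definition C_q :: "(real ^ ('a::finite \<times> 'b::finite \<times> 's::finite \<times> 't::finite)) set"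
  where "C_q = (\<Union>d. C_q_dim d)"

text \<open>Only meaningful for \<open>P \<in> C_q\<close>, as is \<open>A_q\<close>.\<close>

definition D_q :: "real ^ ('a::finite \<times> 'b::finite \<times> 's::finite \<times> 't::finite) \<Rightarrow> nat"
  where "D_q P = (LEAST n. n \<in> {d\<^sup>2 | d. P \<in> C_q_dim d})"

definition A_q :: "real ^ ('a::finite \<times> 'b::finite \<times> 's::finite \<times> 't::finite) \<Rightarrow> real"
  where "A_q P = Inf {(\<Sum>i<n. w i * real (D_q (Q i))) |
    (n :: nat) (w :: nat \<Rightarrow> real) (Q :: nat \<Rightarrow> real ^ ('a \<times> 'b \<times> 's \<times> 't)).
    (\<forall>i<n. 0 \<le> w i) \<and> (\<Sum>i<n. w i) = 1 \<and>
    P = (\<Sum>i<n. w i *\<^sub>R Q i) \<and> (\<forall>i<n. Q i \<in> C_q)}"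

end

theory Submission
  imports Defs
begin

text \<open>
  Suppose \<open>A_q\<close> is bounded on the bounded convex set \<open>C_q\<close>. By Markov's inequality, every \<open>P\<close> in
  \<open>C_q\<close> is then the midpoint of a point of \<open>C_q\<close> and a point of \<open>K\<close>, the convex hull of finitely
  many of the sets \<open>C_q_dim d\<close>. These are compact, so \<open>K\<close> is a compact subset of \<open>C_q\<close>, and the
  midpoint property passes to the closure of \<open>C_q\<close>. For \<open>q\<close> in the closure, let \<open>F\<close> be the smallest
  face of the closure containing \<open>q\<close>. Halving repeatedly inside \<open>F\<close> shows that \<open>F \<inter> C_q\<close> is dense in
  \<open>F\<close>. Hence the two have the same relative interior, which contains \<open>q\<close>. So \<open>C_q\<close> is closed.
\<close>

subsection \<open>A closedness criterion for convex sets\<close>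

lemma closed_if_midpoints_with_compact:
  fixes C K :: "'a::euclidean_space set"
  assumes "convex C" "bounded C" "compact K" "K \<subseteq> C"
    and midpoints: "\<And>x. x \<in> C \<Longrightarrow> \<exists>r\<in>K. \<exists>s\<in>C. x = midpoint r s"
  shows "closed C"
proof -
  define D where "D = closure C"
  have convD: "convex D" and clD: "closed D" and CD: "C \<subseteq> D"
    unfolding D_def using \<open>convex C\<close> closure_subset by auto
  \<comment> \<open>The midpoints of \<open>K\<close> and \<open>D\<close> form the sum of the two
    halved sets. A compact set plus a closed set is closed, so this sum contains \<open>D\<close> as
    soon as it contains \<open>C\<close>.\<close>
  have midD: "\<exists>r\<in>K. \<exists>s\<in>D. x = midpoint r s" if "x \<in> D" for x
  proof -
    have "compact ((*\<^sub>R) (1/2) ` K)" "closed ((*\<^sub>R) (1/2) ` D)"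
      using \<open>compact K\<close> clD by (auto intro: compact_scaling closed_scaling)
    then have "closed (\<Union>y\<in>(*\<^sub>R) (1/2) ` K. \<Union>z\<in>(*\<^sub>R) (1/2) ` D. {y + z})"
      by (rule compact_closed_sums)
    moreover have "C \<subseteq> (\<Union>y\<in>(*\<^sub>R) (1/2) ` K. \<Union>z\<in>(*\<^sub>R) (1/2) ` D. {y + z})"
    proof
      fix y assume "y \<in> C"
      with midpoints obtain r s where "r \<in> K" "s \<in> C" "y = midpoint r s" by blast
      then have "y = (1/2) *\<^sub>R r + (1/2) *\<^sub>R s"
        by (simp add: midpoint_def scaleR_add_right)
      then show "y \<in> (\<Union>y\<in>(*\<^sub>R) (1/2) ` K. \<Union>z\<in>(*\<^sub>R) (1/2) ` D. {y + z})"
        using \<open>r \<in> K\<close> \<open>s \<in> C\<close> CD by blast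
    qed
    ultimately have "D \<subseteq> (\<Union>y\<in>(*\<^sub>R) (1/2) ` K. \<Union>z\<in>(*\<^sub>R) (1/2) ` D. {y + z})"
      unfolding D_def by (rule closure_minimal[rotated])
    with that show ?thesis
      by (fastforce simp: midpoint_def scaleR_add_right)
  qed
  have "q \<in> C" if "q \<in> D" for q
  proof -
    \<comment> \<open>the smallest face of \<open>D\<close> containing \<open>q\<close>\<close>
    define F where "F = {x \<in> D. \<exists>t>0. q + t *\<^sub>R (q - x) \<in> D}"
    define G where "G = F \<inter> C"
    have "q \<in> F"
      using that by (auto simp: F_def intro!: exI[of _ 1])
    \<comment> \<open>The new point lies on the segment from \<open>q\<close> to the given one. So
      the parameter that witnesses membership in \<open>F\<close> may be decreased, and two points
      of \<open>F\<close> can share one parameter.\<close>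
    have shrink: "q + t' *\<^sub>R (q - x) \<in> D" if "q + t *\<^sub>R (q - x) \<in> D" "0 \<le> t'" "t' \<le> t" "t > 0" for t t' x
    proof -
      have "q + t' *\<^sub>R (q - x) = (1 - t'/t) *\<^sub>R q + (t'/t) *\<^sub>R (q + t *\<^sub>R (q - x))"
        using that by (simp add: algebra_simps)
      also have "\<dots> \<in> D"
        using that \<open>q \<in> D\<close> by (intro convexD[OF convD]) auto
      finally show ?thesis .
    qed
    have "convex F"
    proof (rule convexI)
      fix x y and u v :: real
      assume xy: "x \<in> F" "y \<in> F" and uv: "0 \<le> u" "0 \<le> v" "u + v = 1"
      then obtain t1 t2 where t: "t1 > 0" "q + t1 *\<^sub>R (q - x) \<in> D" "t2 > 0" "q + t2 *\<^sub>R (q - y) \<in> D"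
        by (auto simp: F_def)
      define t where "t = min t1 t2"
      have "t > 0" using t by (simp add: t_def)
      have mem: "q + t *\<^sub>R (q - x) \<in> D" "q + t *\<^sub>R (q - y) \<in> D"
        using t \<open>t > 0\<close> by (auto intro: shrink[of t1] shrink[of t2] simp: t_def)
      have "u *\<^sub>R (q + t *\<^sub>R (q - x)) + v *\<^sub>R (q + t *\<^sub>R (q - y))
          = (u + v) *\<^sub>R (q + t *\<^sub>R q) - t *\<^sub>R (u *\<^sub>R x + v *\<^sub>R y)"
        by (simp add: algebra_simps)
      then have "q + t *\<^sub>R (q - (u *\<^sub>R x + v *\<^sub>R y)) = u *\<^sub>R (q + t *\<^sub>R (q - x)) + v *\<^sub>R (q + t *\<^sub>R (q - y))"
        using uv by (simp add: algebra_simps)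
      also have "\<dots> \<in> D"
        using mem uv by (intro convexD[OF convD]) auto
      finally show "u *\<^sub>R x + v *\<^sub>R y \<in> F"
        using xy uv \<open>t > 0\<close> convD by (auto simp: F_def convex_def)
    qed
    then have "convex G"
      using \<open>convex C\<close> by (simp add: G_def convex_Int)
    \<comment> \<open>With \<open>t = 2 * a\<close>, the point extended past the midpoint contains
      \<open>s\<close> with coefficient \<open>- a\<close>. Adding \<open>a\<close> times
      \<open>s\<close> cancels it and leaves \<open>1 + a\<close> times an extension past
      \<open>q\<close> from \<open>r\<close> alone, with parameter
      \<open>a / (1 + a)\<close>.\<close>
    have face: "r \<in> F" if "midpoint r s \<in> F" "r \<in> D" "s \<in> D" for r s
    proof -
      obtain t where t: "t > 0" "q + t *\<^sub>R (q - midpoint r s) \<in> D"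
        using \<open>midpoint r s \<in> F\<close> by (auto simp: F_def)
      define a where "a = t/2"
      have "a > 0" "t = 2 * a" using t by (auto simp: a_def)
      have "(1 + a) *\<^sub>R (q + (a / (1 + a)) *\<^sub>R (q - r)) = (q + t *\<^sub>R (q - midpoint r s)) + a *\<^sub>R s"
      proof -
        have "(1 + a) *\<^sub>R (q + (a / (1 + a)) *\<^sub>R (q - r)) = (1 + a) *\<^sub>R q + a *\<^sub>R (q - r)"
          using \<open>a > 0\<close> by (simp add: scaleR_add_right)
        also have "\<dots> = (q + t *\<^sub>R (q - midpoint r s)) + a *\<^sub>R s"
          by (simp add: \<open>t = 2 * a\<close> midpoint_def algebra_simps)
            (simp flip: scaleR_left_distrib)
        finally show ?thesis .
      qed
      then have "(1 / (1 + a)) *\<^sub>R (1 + a) *\<^sub>R (q + (a / (1 + a)) *\<^sub>R (q - r))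
          = (1 / (1 + a)) *\<^sub>R ((q + t *\<^sub>R (q - midpoint r s)) + a *\<^sub>R s)"
        by simp
      then have "q + (a / (1 + a)) *\<^sub>R (q - r)
          = (1 / (1 + a)) *\<^sub>R (q + t *\<^sub>R (q - midpoint r s)) + (a / (1 + a)) *\<^sub>R s"
        using \<open>a > 0\<close> by (simp add: scaleR_add_right)
      also have "\<dots> \<in> D"
        using t \<open>a > 0\<close> \<open>s \<in> D\<close> by (intro convexD[OF convD]) (auto simp: field_simps)
      finally show ?thesis
        using \<open>r \<in> D\<close> \<open>a > 0\<close> by (auto simp: F_def intro!: exI[of _ "a / (1 + a)"])
    qed
    \<comment> \<open>The face property, applied to both endpoints, keeps the decomposition from
      \<open>midD\<close> inside \<open>F\<close>; the endpoint taken from \<open>K\<close> also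
      lies in \<open>C\<close>.\<close>
    have split: "\<exists>r\<in>G. \<exists>s\<in>F. z = midpoint r s" if "z \<in> F" for z
    proof -
      from that have "z \<in> D" by (simp add: F_def)
      with midD obtain r s where rs: "r \<in> K" "s \<in> D" "z = midpoint r s" by blast
      then have "r \<in> D" using \<open>K \<subseteq> C\<close> CD by blast
      have "r \<in> F" "s \<in> F"
        using face[of r s] face[of s r] that rs \<open>r \<in> D\<close> by (auto simp: midpoint_sym)
      then show ?thesis
        using rs \<open>K \<subseteq> C\<close> by (auto simp: G_def)
    qed
    have "bounded D" using \<open>bounded C\<close> by (simp add: D_def bounded_closure)
    then obtain B where B: "\<And>x y. x \<in> D \<Longrightarrow> y \<in> D \<Longrightarrow> dist x y \<le> B"
      by (meson bounded_two_points)
    \<comment> \<open>In \<open>z = midpoint r s\<close> the point \<open>r\<close> is already in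
      \<open>G\<close>. Replacing \<open>s\<close> by an approximant in \<open>G\<close> halves the
      error, and convexity keeps the new midpoint in \<open>G\<close>. The diameter bound
      \<open>B\<close> starts the induction.\<close>
    have approx: "\<exists>g\<in>G. dist z g \<le> B / 2 ^ n" if "z \<in> F" for z n
      using that
    proof (induction n arbitrary: z)
      case 0
      from split[OF 0] obtain r where "r \<in> G" by blast
      with 0 show ?case
        by (intro bexI[of _ r]) (auto intro!: B simp: F_def G_def)
    next
      case (Suc n)
      from split[OF Suc.prems] obtain r s where rs: "r \<in> G" "s \<in> F" "z = midpoint r s" by blast
      from Suc.IH[OF \<open>s \<in> F\<close>] obtain g where g: "g \<in> G" "dist s g \<le> B / 2 ^ n" by blast
      have mem: "midpoint r g \<in> G"
        using \<open>convex G\<close> rs g by (auto simp: midpoint_def scaleR_add_right convex_def)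
      have "dist z (midpoint r g) = dist s g / 2"
      proof -
        have "z - midpoint r g = (1/2) *\<^sub>R (s - g)"
          by (simp add: rs(3) midpoint_def algebra_simps)
        then show ?thesis by (simp add: dist_norm)
      qed
      then have "dist z (midpoint r g) \<le> B / 2 ^ Suc n"
        using g(2) by simp
      with mem show ?case by blast
    qed
    have dense: "F \<subseteq> closure G"
    proof
      fix z assume "z \<in> F"
      show "z \<in> closure G"
        unfolding closure_approachable
      proof (intro allI impI)
        fix e :: real assume "e > 0"
        have "(\<lambda>n. B / 2 ^ n) \<longlonglongrightarrow> 0" by (rule LIMSEQ_divide_realpow_zero) simp
        then have "\<forall>\<^sub>F n in sequentially. B / 2 ^ n < e"
          using \<open>e > 0\<close> by (rule order_tendstoD)
        then obtain n where "B / 2 ^ n < e"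
          by (auto simp: eventually_sequentially)
        with approx[OF \<open>z \<in> F\<close>, of n] show "\<exists>y\<in>G. dist y z < e"
          by (force simp: dist_commute)
      qed
    qed
    have "G \<noteq> {}" using split[OF \<open>q \<in> F\<close>] by blast
    then obtain x0 where x0: "x0 \<in> rel_interior G"
      using rel_interior_eq_empty[OF \<open>convex G\<close>] by blast
    then have "x0 \<in> F" using rel_interior_subset G_def by blast
    then obtain t where t: "t > 0" "q + t *\<^sub>R (q - x0) \<in> D" "x0 \<in> D" by (auto simp: F_def)
    \<comment> \<open>\<open>y\<close> prolongs the segment from \<open>x0\<close> through
      \<open>q\<close>. Then \<open>q\<close> lies strictly between a relative interior point of
      \<open>G\<close> and a point of its closure, hence is itself in the relative interior.\<close>
    define y where "y = q + t *\<^sub>R (q - x0)"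
    \<comment> \<open>Prolonging the other way, from \<open>y\<close> through \<open>q\<close>,
      returns to \<open>x0\<close>; this puts \<open>y\<close> in \<open>F\<close>.\<close>
    have "q + (1/t) *\<^sub>R (q - y) = x0"
      using t by (simp add: y_def)
    then have "y \<in> F"
      using t by (auto simp: F_def y_def[symmetric] intro!: exI[of _ "1/t"])
    then have "y - (t / (1 + t)) *\<^sub>R (y - x0) \<in> rel_interior G"
      using dense t by (intro rel_interior_closure_convex_shrink[OF \<open>convex G\<close> x0]) auto
    moreover have "y - (t / (1 + t)) *\<^sub>R (y - x0) = q"
    proof -
      have "y - x0 = (1 + t) *\<^sub>R (q - x0)" by (simp add: y_def algebra_simps)
      then show ?thesis using t by (simp add: y_def)
    qed
    ultimately show "q \<in> C"
      using rel_interior_subset G_def by blast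
  qed
  then have "D = C" using CD by blast
  then show ?thesis using clD by simp
qed

subsection \<open>Quantum correlations in coordinates\<close>

type_synonym kernel = "nat \<Rightarrow> nat \<Rightarrow> complex"

text \<open>Matrices and vectors are replaced by functions of their indices, of which only the values at
  indices below \<open>d\<close> matter, in order to use the product topology and Tychonoff's theorem.\<close>

definition psd_kernel :: "nat \<Rightarrow> kernel \<Rightarrow> bool"
  where "psd_kernel d M \<longleftrightarrow> (\<forall>i<d. \<forall>j<d. cnj (M j i) = M i j) \<and>
    (\<forall>v. 0 \<le> (\<Sum>i<d. \<Sum>j<d. M i j * v j * cnj (v i)))"

definition povm_kernel :: "nat \<Rightarrow> ('x::finite \<Rightarrow> kernel) \<Rightarrow> bool"
  where "povm_kernel d E \<longleftrightarrow> (\<forall>x. psd_kernel d (E x)) \<and>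
    (\<forall>i<d. \<forall>j<d. (\<Sum>x\<in>UNIV. E x i j) = (if i = j then 1 else 0))"

text \<open>The quadratic form of the tensor product of \<open>M\<close> and \<open>N\<close> at the
  state \<open>\<psi>\<close>, whose two indices belong to the two tensor factors.\<close>

definition born :: "nat \<Rightarrow> kernel \<Rightarrow> kernel \<Rightarrow>
    kernel \<Rightarrow> complex"
  where "born d M N \<psi> =
    (\<Sum>i<d. \<Sum>j<d. \<Sum>k<d. \<Sum>l<d. M i k * N j l * \<psi> k l * cnj (\<psi> i j))"

lemma psd_kernel_cong:
  assumes "\<And>i j. i < d \<Longrightarrow> j < d \<Longrightarrow> M i j = N i j"
  shows "psd_kernel d M \<longleftrightarrow> psd_kernel d N"
  using assms by (simp add: psd_kernel_def)

lemma povm_kernel_cong: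
  assumes "\<And>x i j. i < d \<Longrightarrow> j < d \<Longrightarrow> E x i j = F x i j"
  shows "povm_kernel d E \<longleftrightarrow> povm_kernel d F"
  using assms psd_kernel_cong[of d "E _" "F _"] by (simp add: povm_kernel_def)

lemma cscalar_prod_mult_mat_vec:
  fixes M :: "complex mat"
  assumes "M \<in> carrier_mat n n" "v \<in> carrier_vec n"
  shows "(M *\<^sub>v v) \<bullet>c v = (\<Sum>i<n. \<Sum>j<n. M $$ (i, j) * vec_index v j * cnj (vec_index v i))"
  using assms by (simp add: scalar_prod_def atLeast0LessThan sum_distrib_right)

lemma hermitian_psd_iff:
  "hermitian_psd d M \<longleftrightarrow> M \<in> carrier_mat d d \<and> psd_kernel d (\<lambda>i j. M $$ (i, j))"
proof (cases "M \<in> carrier_mat d d")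
  case True
  have adj: "mat_adjoint M \<in> carrier_mat d d"
    "\<And>i j. i < d \<Longrightarrow> j < d \<Longrightarrow> mat_adjoint M $$ (i, j) = cnj (M $$ (j, i))"
    using True by (auto simp: mat_adjoint_def mat_of_rows_def)
  have "mat_adjoint M = M \<longleftrightarrow> (\<forall>i<d. \<forall>j<d. cnj (M $$ (j, i)) = M $$ (i, j))"
    using True adj by (auto simp: mat_eq_iff)
  moreover note form = cscalar_prod_mult_mat_vec[OF True]
  have "(\<forall>v \<in> carrier_vec d. 0 \<le> (M *\<^sub>v v) \<bullet>c v) \<longleftrightarrow>
      (\<forall>v. 0 \<le> (\<Sum>i<d. \<Sum>j<d. M $$ (i, j) * v j * cnj (v i)))" (is "?L \<longleftrightarrow> ?R")
  proof
    assume ?L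
    show ?R
    proof
      fix v :: "nat \<Rightarrow> complex"
      show "0 \<le> (\<Sum>i<d. \<Sum>j<d. M $$ (i, j) * v j * cnj (v i))"
        using \<open>?L\<close>[rule_format, of "vec d v"] form[of "vec d v"] by simp
    qed
  next
    assume ?R
    then show ?L by (simp add: form)
  qed
  ultimately show ?thesis
    using True by (simp add: hermitian_psd_def psd_kernel_def)
qed (simp add: hermitian_psd_def)

lemma povm_iff:
  "povm d E \<longleftrightarrow> (\<forall>x. E x \<in> carrier_mat d d) \<and> povm_kernel d (\<lambda>x i j. E x $$ (i, j))"
  by (auto simp: povm_def povm_kernel_def hermitian_psd_iff mat_eq_iff)

text \<open>The index \<open>j + i * d\<close> encodes the pair \<open>(i, j)\<close> in the
  Kronecker convention, written in the form in which \<open>sum_mult_product\<close> splits a sum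
  over \<open>d * d\<close> indices into a double sum.\<close>

lemma tensor_form:
  assumes "M \<in> carrier_mat d d" "N \<in> carrier_mat d d" "\<psi> \<in> carrier_vec (d * d)"
  shows "((M \<otimes>\<^sub>m N) *\<^sub>v \<psi>) \<bullet>c \<psi> =
    born d (\<lambda>i j. M $$ (i, j)) (\<lambda>i j. N $$ (i, j)) (\<lambda>i j. vec_index \<psi> (j + i * d))"
proof -
  have lt: "j + i * d < d * d" if "i < d" "j < d" for i j
  proof -
    have "j + i * d < Suc i * d" using that by simp
    also have "\<dots> \<le> d * d" using that by (intro mult_le_mono1) simp
    finally show ?thesis .
  qed
  have car: "M \<otimes>\<^sub>m N \<in> carrier_mat (d * d) (d * d)"
    using assms unfolding tensor_mat_def by simp
  have entry: "(M \<otimes>\<^sub>m N) $$ (j + i * d, l + k * d) = M $$ (i, k) * N $$ (j, l)"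
    if "i < d" "j < d" "k < d" "l < d" for i j k l
    using lt[of i j] lt[of k l] assms(1,2) that unfolding tensor_mat_def by simp
  show ?thesis
    unfolding cscalar_prod_mult_mat_vec[OF car assms(3)] born_def sum_mult_product
    by (intro sum.cong refl) (simp add: entry)
qed
text \<open>Kernels carry no dimension conditions, so direct sums and the product topology apply to
  them directly.\<close>

lemma C_q_dim_iff:
  fixes P :: "real ^ ('a::finite \<times> 'b::finite \<times> 's::finite \<times> 't::finite)"
  shows "P \<in> C_q_dim d \<longleftrightarrow> correlation P \<and>
    (\<exists>\<psi> (E :: 's \<Rightarrow> 'a \<Rightarrow> kernel) (F :: 't \<Rightarrow> 'b \<Rightarrow> kernel).
      (\<Sum>i<d. \<Sum>j<d. \<psi> i j * cnj (\<psi> i j)) = 1 \<and>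
      (\<forall>s. povm_kernel d (E s)) \<and> (\<forall>t. povm_kernel d (F t)) \<and>
      (\<forall>a b s t. complex_of_real (vec_nth P (a, b, s, t)) = born d (E s a) (F t b) \<psi>))"
    (is "_ \<longleftrightarrow> _ \<and> ?R")
proof -
  have norm: "\<psi> \<bullet>c \<psi> = (\<Sum>i<d. \<Sum>j<d. vec_index \<psi> (j + i * d) * cnj (vec_index \<psi> (j + i * d)))"
    if "\<psi> \<in> carrier_vec (d * d)" for \<psi> :: "complex vec"
    using that by (simp add: scalar_prod_def atLeast0LessThan sum_mult_product)
  have "?R" if P: "P \<in> C_q_dim d"
  proof -
    obtain \<psi> and E :: "'s \<Rightarrow> 'a \<Rightarrow> complex mat" and F :: "'t \<Rightarrow> 'b \<Rightarrow> complex mat"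
      where *: "\<psi> \<in> carrier_vec (d * d)" "\<psi> \<bullet>c \<psi> = 1" "\<And>s. povm d (E s)" "\<And>t. povm d (F t)"
        "\<And>a b s t. complex_of_real (vec_nth P (a, b, s, t)) = ((E s a \<otimes>\<^sub>m F t b) *\<^sub>v \<psi>) \<bullet>c \<psi>"
      using P unfolding C_q_dim_def by blast
    then have carrier: "\<And>s a. E s a \<in> carrier_mat d d" "\<And>t b. F t b \<in> carrier_mat d d"
      by (simp_all add: povm_iff)
    show ?thesis
      using * norm[OF *(1)] tensor_form[OF carrier *(1)]
      by (intro exI[of _ "\<lambda>i j. vec_index \<psi> (j + i * d)"] exI[of _ "\<lambda>s a i j. E s a $$ (i, j)"]
            exI[of _ "\<lambda>t b i j. F t b $$ (i, j)"]) (simp add: povm_iff)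
  qed
  moreover have "P \<in> C_q_dim d" if ?R "correlation P"
  proof -
    obtain \<psi> and E :: "'s \<Rightarrow> 'a \<Rightarrow> kernel" and F :: "'t \<Rightarrow> 'b \<Rightarrow> kernel"
      where *: "(\<Sum>i<d. \<Sum>j<d. \<psi> i j * cnj (\<psi> i j)) = 1"
        "\<And>s. povm_kernel d (E s)" "\<And>t. povm_kernel d (F t)"
        "\<And>a b s t. complex_of_real (vec_nth P (a, b, s, t)) = born d (E s a) (F t b) \<psi>"
      using \<open>?R\<close> by blast
    \<comment> \<open>The flattening inverse to reading off the entries at
      \<open>j + i * d\<close>.\<close>
    define \<phi> where "\<phi> = vec (d * d) (\<lambda>p. \<psi> (p div d) (p mod d))"
    define E' where "E' s a = mat d d (\<lambda>(i, j). E s a i j)" for s a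
    define F' where "F' t b = mat d d (\<lambda>(i, j). F t b i j)" for t b
    have car: "\<phi> \<in> carrier_vec (d * d)" "E' s a \<in> carrier_mat d d" "F' t b \<in> carrier_mat d d" for s a t b
      by (simp_all add: \<phi>_def E'_def F'_def)
    have \<phi>: "vec_index \<phi> (j + i * d) = \<psi> i j" if "i < d" "j < d" for i j
    proof -
      have "j + i * d < Suc i * d" using that by simp
      also have "\<dots> \<le> d * d" using that by (intro mult_le_mono1) simp
      finally show ?thesis using that by (simp add: \<phi>_def)
    qed
    have "povm d (E' s)" "povm d (F' t)" for s t
      using *(2)[of s] *(3)[of t]
        povm_kernel_cong[of d "\<lambda>a i j. E' s a $$ (i, j)" "E s"]
        povm_kernel_cong[of d "\<lambda>b i j. F' t b $$ (i, j)" "F t"]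
      by (simp_all add: povm_iff car) (simp_all add: E'_def F'_def)
    moreover have "\<phi> \<bullet>c \<phi> = 1"
      using *(1) by (simp add: norm[OF car(1)] \<phi>)
    moreover have "((E' s a \<otimes>\<^sub>m F' t b) *\<^sub>v \<phi>) \<bullet>c \<phi> = born d (E s a) (F t b) \<psi>" for s a t b
      unfolding tensor_form[OF car(2,3,1)] born_def
      by (intro sum.cong refl) (simp add: \<phi> E'_def F'_def)
    ultimately show ?thesis
      using car \<open>correlation P\<close> *(4) unfolding C_q_dim_def mem_Collect_eq
      by (intro conjI exI[of _ \<phi>] exI[of _ E'] exI[of _ F']) simp_all
  qed
  moreover have "correlation P" if "P \<in> C_q_dim d"
    using that by (simp add: C_q_dim_def)
  ultimately show ?thesis by blast
qed

subsection \<open>Convexity\<close>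

lemma born_cong:
  assumes "\<And>i j. i < d \<Longrightarrow> j < d \<Longrightarrow> M i j = M' i j"
    "\<And>i j. i < d \<Longrightarrow> j < d \<Longrightarrow> N i j = N' i j"
    "\<And>i j. i < d \<Longrightarrow> j < d \<Longrightarrow> \<psi> i j = \<psi>' i j"
  shows "born d M N \<psi> = born d M' N' \<psi>'"
  unfolding born_def using assms by (intro sum.cong refl) simp

lemma correlation_convex:
  assumes "correlation P" "correlation Q" "0 \<le> u" "0 \<le> v" "u + v = 1"
  shows "correlation (u *\<^sub>R P + v *\<^sub>R Q)"
  using assms by (auto simp: correlation_def sum.distrib simp flip: sum_distrib_left)

lemma correlation_nth_le_1:
  assumes "correlation P"
  shows "vec_nth P (a, b, s, t) \<le> 1"
proof -
  have "vec_nth P (a, b, s, t) \<le> (\<Sum>b\<in>UNIV. vec_nth P (a, b, s, t))"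
    using assms by (intro member_le_sum) (auto simp: correlation_def)
  also have "\<dots> \<le> (\<Sum>a\<in>UNIV. \<Sum>b\<in>UNIV. vec_nth P (a, b, s, t))"
    using assms by (intro member_le_sum sum_nonneg) (auto simp: correlation_def)
  also have "\<dots> = 1" using assms by (simp add: correlation_def)
  finally show ?thesis .
qed

lemma bounded_C_q: "bounded C_q"
proof -
  have "C_q \<subseteq> cbox 0 (\<chi> _. 1)"
    by (auto simp: C_q_def C_q_dim_def mem_box_cart correlation_nth_le_1)
      (simp add: correlation_def)
  then show ?thesis using bounded_cbox bounded_subset by blast
qed

text \<open>Block-diagonal sum with first block of size \<open>d\<close>. The size of the second
  block is left open, since only indices below the total dimension are ever read. The same
  construction serves for operators and for the coefficient arrays of states.\<close>

definition direct_sum :: "nat \<Rightarrow> kernel \<Rightarrow> kernel \<Rightarrow> kernel"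
  where "direct_sum d M N i j = (if i < d \<and> j < d then M i j
    else if d \<le> i \<and> d \<le> j then N (i - d) (j - d) else 0)"

lemma direct_sum_simps [simp]:
  "i < d \<Longrightarrow> j < d \<Longrightarrow> direct_sum d M N i j = M i j"
  "i < d \<Longrightarrow> direct_sum d M N i (d + l) = 0"
  "j < d \<Longrightarrow> direct_sum d M N (d + k) j = 0"
  "direct_sum d M N (d + k) (d + l) = N k l"
  by (auto simp: direct_sum_def)

lemma sum_lessThan_add:
  fixes f :: "nat \<Rightarrow> 'a::comm_monoid_add"
  shows "sum f {..<m + n} = sum f {..<m} + (\<Sum>j<n. f (m + j))"
  by (induction n) (simp_all add: ac_simps)

lemma less_add_cases:
  assumes "i < m + (n::nat)"
  obtains "i < m" | k where "i = m + k" "k < n"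
  using assms by (metis add_diff_inverse_nat nat_add_left_cancel_less)

lemma psd_kernel_direct_sum:
  assumes "psd_kernel d M" "psd_kernel e N"
  shows "psd_kernel (d + e) (direct_sum d M N)"
  unfolding psd_kernel_def
proof (intro conjI allI impI)
  fix i j assume "i < d + e" "j < d + e"
  then show "cnj (direct_sum d M N j i) = direct_sum d M N i j"
    using assms by (elim less_add_cases) (auto simp: psd_kernel_def)
next
  fix v :: "nat \<Rightarrow> complex"
  \<comment> \<open>The off-diagonal blocks vanish, so the form splits into the two original forms,
    the second evaluated at the shifted tail of \<open>v\<close>.\<close>
  have "(\<Sum>i<d + e. \<Sum>j<d + e. direct_sum d M N i j * v j * cnj (v i)) =
      (\<Sum>i<d. \<Sum>j<d. M i j * v j * cnj (v i)) +
      (\<Sum>i<e. \<Sum>j<e. N i j * v (d + j) * cnj (v (d + i)))"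
    by (simp add: sum_lessThan_add sum.distrib cong: sum.cong_simp)
  moreover have "0 \<le> (\<Sum>i<d. \<Sum>j<d. M i j * v j * cnj (v i))"
    using assms by (simp add: psd_kernel_def)
  moreover have "0 \<le> (\<Sum>i<e. \<Sum>j<e. N i j * v (d + j) * cnj (v (d + i)))"
    using assms(2)[unfolded psd_kernel_def] by (elim conjE allE[of _ "\<lambda>j. v (d + j)"])
  ultimately show "0 \<le> (\<Sum>i<d + e. \<Sum>j<d + e. direct_sum d M N i j * v j * cnj (v i))"
    by simp
qed

lemma povm_kernel_direct_sum:
  assumes "povm_kernel d E" "povm_kernel e F"
  shows "povm_kernel (d + e) (\<lambda>x. direct_sum d (E x) (F x))"
  unfolding povm_kernel_def
proof (intro conjI allI impI)
  show "psd_kernel (d + e) (direct_sum d (E x) (F x))" for x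
    using assms by (simp add: povm_kernel_def psd_kernel_direct_sum)
next
  fix i j assume "i < d + e" "j < d + e"
  then show "(\<Sum>x\<in>UNIV. direct_sum d (E x) (F x) i j) = (if i = j then 1 else 0)"
    using assms by (elim less_add_cases) (auto simp: povm_kernel_def)
qed

text \<open>The combined state has no component pairing one party's first block with the other
  party's second block, and block-diagonal operators create none; hence there are no cross
  terms.\<close>

lemma born_direct_sum:
  "born (d + e) (direct_sum d M M') (direct_sum d N N') (direct_sum d \<psi> \<psi>') =
    born d M N \<psi> + born e M' N' \<psi>'"
  by (simp add: born_def sum_lessThan_add sum.distrib cong: sum.cong_simp)

lemma born_scale:
  "born d M N (\<lambda>i j. complex_of_real c * \<psi> i j) = complex_of_real (c\<^sup>2) * born d M N \<psi>"
  unfolding born_def sum_distrib_left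
  by (intro sum.cong refl) (simp add: power2_eq_square)

text \<open>The mixture is encoded in the state: the two states are scaled by \<open>sqrt u\<close>
  and \<open>sqrt v\<close> and put into separate blocks. The form is quadratic in the state, so the
  blocks contribute with weights \<open>u\<close> and \<open>v\<close>. The dimensions add, which is
  harmless for the union over all \<open>d\<close>.\<close>

lemma C_q_dim_convex:
  fixes P Q :: "real ^ ('a::finite \<times> 'b::finite \<times> 's::finite \<times> 't::finite)"
  assumes "P \<in> C_q_dim d" "Q \<in> C_q_dim e" "0 \<le> u" "0 \<le> v" "u + v = 1"
  shows "u *\<^sub>R P + v *\<^sub>R Q \<in> C_q_dim (d + e)"
proof -
  obtain \<psi> and E :: "'s \<Rightarrow> 'a \<Rightarrow> kernel" and F :: "'t \<Rightarrow> 'b \<Rightarrow> kernel"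
    where 1: "(\<Sum>i<d. \<Sum>j<d. \<psi> i j * cnj (\<psi> i j)) = 1"
      "\<And>s. povm_kernel d (E s)" "\<And>t. povm_kernel d (F t)"
      "\<And>a b s t. complex_of_real (vec_nth P (a, b, s, t)) = born d (E s a) (F t b) \<psi>"
    using assms(1) unfolding C_q_dim_iff by blast
  obtain \<psi>' and E' :: "'s \<Rightarrow> 'a \<Rightarrow> kernel" and F' :: "'t \<Rightarrow> 'b \<Rightarrow> kernel"
    where 2: "(\<Sum>i<e. \<Sum>j<e. \<psi>' i j * cnj (\<psi>' i j)) = 1"
      "\<And>s. povm_kernel e (E' s)" "\<And>t. povm_kernel e (F' t)"
      "\<And>a b s t. complex_of_real (vec_nth Q (a, b, s, t)) = born e (E' s a) (F' t b) \<psi>'"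
    using assms(2) unfolding C_q_dim_iff by blast
  let ?\<phi> = "direct_sum d (\<lambda>i j. complex_of_real (sqrt u) * \<psi> i j) (\<lambda>i j. complex_of_real (sqrt v) * \<psi>' i j)"
  have sq: "complex_of_real (sqrt c) * z * (complex_of_real (sqrt c) * w) = complex_of_real c * (z * w)"
    if "0 \<le> c" for c z w
  proof -
    have "complex_of_real (sqrt c) * complex_of_real (sqrt c) = complex_of_real c"
      using that by (simp flip: of_real_mult)
    then show ?thesis by (metis mult.assoc mult.left_commute)
  qed
  have "(\<Sum>i<d + e. \<Sum>j<d + e. ?\<phi> i j * cnj (?\<phi> i j)) =
     complex_of_real u * (\<Sum>i<d. \<Sum>j<d. \<psi> i j * cnj (\<psi> i j)) +
     complex_of_real v * (\<Sum>i<e. \<Sum>j<e. \<psi>' i j * cnj (\<psi>' i j))"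
    using assms(3,4) by (simp add: sum_lessThan_add sum.distrib sum_distrib_left sq cong: sum.cong_simp)
  also have "\<dots> = 1"
    using assms(5) by (simp add: 1(1) 2(1) flip: of_real_add)
  finally have "(\<Sum>i<d + e. \<Sum>j<d + e. ?\<phi> i j * cnj (?\<phi> i j)) = 1" .
  moreover have "complex_of_real (vec_nth (u *\<^sub>R P + v *\<^sub>R Q) (a, b, s, t)) =
      born (d + e) (direct_sum d (E s a) (E' s a)) (direct_sum d (F t b) (F' t b)) ?\<phi>" for a b s t
    using assms(3,4) by (simp add: born_direct_sum born_scale 1(4) 2(4))
  moreover have "correlation (u *\<^sub>R P + v *\<^sub>R Q)"
    using assms by (intro correlation_convex) (auto simp: C_q_dim_def)
  ultimately show ?thesis
    unfolding C_q_dim_iff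
    by (intro conjI exI[of _ ?\<phi>] exI[of _ "\<lambda>s a. direct_sum d (E s a) (E' s a)"]
          exI[of _ "\<lambda>t b. direct_sum d (F t b) (F' t b)"])
      (auto intro: povm_kernel_direct_sum 1 2)
qed

lemma convex_C_q: "convex C_q"
  by (rule convexI) (auto simp: C_q_def intro: C_q_dim_convex)

subsection \<open>Compactness in fixed dimension\<close>

lemma sum_eq_single:
  fixes f :: "nat \<Rightarrow> 'a::comm_monoid_add"
  assumes "i < d" "\<And>k. k \<noteq> i \<Longrightarrow> f k = 0"
  shows "sum f {..<d} = f i"
proof -
  have "sum f {..<d} = sum f {i}"
    using assms by (intro sum.mono_neutral_right) auto
  then show ?thesis by simp
qed

lemma sum_eq_two:
  fixes f :: "nat \<Rightarrow> 'a::comm_monoid_add"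
  assumes "i < d" "j < d" "i \<noteq> j" "\<And>k. k \<noteq> i \<Longrightarrow> k \<noteq> j \<Longrightarrow> f k = 0"
  shows "sum f {..<d} = f i + f j"
proof -
  have "sum f {..<d} = sum f {i, j}"
    using assms by (intro sum.mono_neutral_right) auto
  then show ?thesis using assms by simp
qed

lemma psd_kernel_diag_nonneg:
  assumes "psd_kernel d M" "i < d"
  shows "0 \<le> M i i"
proof -
  \<comment> \<open>Testing the form on a basis vector isolates one diagonal entry.\<close>
  define v :: "nat \<Rightarrow> complex" where "v k = (if k = i then 1 else 0)" for k
  have v: "v i = 1" "\<And>k. k \<noteq> i \<Longrightarrow> v k = 0"
    by (simp_all add: v_def)
  have inner: "(\<Sum>l<d. M k l * v l * cnj (v k)) = M k i * cnj (v k)" for k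
    using assms(2) v by (subst sum_eq_single[of i]) auto
  have "0 \<le> (\<Sum>k<d. \<Sum>l<d. M k l * v l * cnj (v k))"
    using assms by (simp add: psd_kernel_def)
  also have "\<dots> = (\<Sum>k<d. M k i * cnj (v k))"
    by (simp only: inner)
  also have "\<dots> = M i i"
    using assms(2) v by (subst sum_eq_single[of i]) auto
  finally show ?thesis .
qed

text \<open>The form is tested on a vector with entry 1 at \<open>i\<close> and \<open>y\<close> at
  \<open>j\<close>. The phase of \<open>y\<close> turns both off-diagonal terms into
  \<open>- cmod (M i j)\<close>. Only \<open>cmod y \<le> 1\<close> is available, because
  \<open>sgn\<close> is 0 when the entry vanishes.\<close>

lemma psd_kernel_off_diag_bound:
  assumes M: "psd_kernel d M" and ij: "i < d" "j < d" "i \<noteq> j"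
  shows "2 * cmod (M i j) \<le> Re (M i i) + Re (M j j)"
proof -
  define y where "y = - cnj (sgn (M i j))"
  define v :: "nat \<Rightarrow> complex" where "v k = (if k = i then 1 else if k = j then y else 0)" for k
  have v: "v i = 1" "v j = y" "\<And>k. k \<noteq> i \<Longrightarrow> k \<noteq> j \<Longrightarrow> v k = 0"
    using ij by (auto simp: v_def)
  have inner: "(\<Sum>l<d. M k l * v l * cnj (v k)) = M k i * cnj (v k) + M k j * y * cnj (v k)" for k
    using ij v by (subst sum_eq_two[of i d j]) auto
  have "0 \<le> (\<Sum>k<d. \<Sum>l<d. M k l * v l * cnj (v k))"
    using M by (simp add: psd_kernel_def)
  also have "\<dots> = (\<Sum>k<d. M k i * cnj (v k) + M k j * y * cnj (v k))"
    by (simp only: inner)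
  also have "\<dots> = M i i + M i j * y + (M j i * cnj y + M j j * y * cnj y)"
    using ij v by (subst sum_eq_two[of i d j]) auto
  finally have form: "0 \<le> M i i + M i j * y + (M j i * cnj y + M j j * y * cnj y)" .
  have "M i j * y = - (M i j * cnj (M i j)) / complex_of_real (cmod (M i j))"
    by (simp add: y_def sgn_eq)
  also have "\<dots> = - complex_of_real (cmod (M i j))"
    unfolding complex_norm_square[symmetric] by (simp add: power2_eq_square)
  finally have off: "M i j * y = - complex_of_real (cmod (M i j))" .
  have "M j i * cnj y = cnj (M i j * y)"
    using M ij by (simp add: psd_kernel_def)
  then have "Re (M j i * cnj y) = - cmod (M i j)"
    by (simp add: off)
  moreover have "Re (M j j * y * cnj y) \<le> Re (M j j)"
  proof -
    have eq: "M j j * y * cnj y = M j j * complex_of_real ((cmod y)\<^sup>2)"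
      by (simp only: complex_norm_square mult.assoc)
    have "Re (M j j * y * cnj y) = Re (M j j) * (cmod y)\<^sup>2"
      unfolding eq by (simp del: of_real_power)
    moreover have "cmod y \<le> 1" by (simp add: y_def norm_sgn)
    moreover have "0 \<le> Re (M j j)"
      using psd_kernel_diag_nonneg[OF M ij(2)] by (simp add: less_eq_complex_def)
    ultimately show ?thesis by (simp add: mult_left_le power_le_one del: times_complex.sel)
  qed
  moreover have "0 \<le> Re (M i i + M i j * y + (M j i * cnj y + M j j * y * cnj y))"
    using form unfolding less_eq_complex_def zero_complex.sel by (rule conjunct1)
  moreover have "Re (M i j * y) = - cmod (M i j)"
    by (simp add: off)
  ultimately show ?thesis unfolding plus_complex.sel by linarith
qed

text \<open>For each diagonal position, the nonnegative entries of all outcomes sum to 1, so each is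
  at most 1. An off-diagonal entry is bounded by the mean of two diagonal ones.\<close>

lemma povm_kernel_norm_le_1:
  assumes E: "povm_kernel d E" and ij: "i < d" "j < d"
  shows "cmod (E x i j) \<le> 1"
proof -
  have psd: "psd_kernel d (E y)" for y
    using E by (simp add: povm_kernel_def)
  have diag: "0 \<le> Re (E y k k)" "Im (E y k k) = 0" if "k < d" for y k
    using psd_kernel_diag_nonneg[OF psd that, of y] by (auto simp: less_eq_complex_def)
  have le1: "Re (E x k k) \<le> 1" if "k < d" for k
  proof -
    have "Re (E x k k) \<le> (\<Sum>y\<in>UNIV. Re (E y k k))"
      using diag that by (intro member_le_sum) auto
    also have "\<dots> = Re (\<Sum>y\<in>UNIV. E y k k)" by simp
    also have "\<dots> = 1" using E that by (simp add: povm_kernel_def del: Re_sum)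
    finally show ?thesis .
  qed
  show ?thesis
  proof (cases "i = j")
    case True
    then show ?thesis using diag le1 ij by (simp add: cmod_def)
  next
    case False
    then show ?thesis
      using psd_kernel_off_diag_bound[OF psd ij False, of x] le1[OF ij(1)] le1[OF ij(2)] by linarith
  qed
qed

lemma unit_kernel_norm_le_1:
  fixes \<psi> :: kernel
  assumes "(\<Sum>i<d. \<Sum>j<d. \<psi> i j * cnj (\<psi> i j)) = 1" "i < d" "j < d"
  shows "cmod (\<psi> i j) \<le> 1"
proof -
  have "complex_of_real (\<Sum>i<d. \<Sum>j<d. (cmod (\<psi> i j))\<^sup>2) = 1"
    using assms(1) by (simp add: complex_norm_square del: of_real_power)
  then have "(\<Sum>i<d. \<Sum>j<d. (cmod (\<psi> i j))\<^sup>2) = 1"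
    using of_real_eq_1_iff by blast
  moreover have "(cmod (\<psi> i j))\<^sup>2 \<le> (\<Sum>j<d. (cmod (\<psi> i j))\<^sup>2)"
    using assms by (intro member_le_sum[of j _ "\<lambda>j. (cmod (\<psi> i j))\<^sup>2"]) auto
  moreover have "\<dots> \<le> (\<Sum>i<d. \<Sum>j<d. (cmod (\<psi> i j))\<^sup>2)"
    using assms by (intro member_le_sum[of i _ "\<lambda>i. \<Sum>j<d. (cmod (\<psi> i j))\<^sup>2"] sum_nonneg) auto
  ultimately have "(cmod (\<psi> i j))\<^sup>2 \<le> 1" by linarith
  then show ?thesis by (simp add: power_le_one_iff abs_square_le_1)
qed

text \<open>Tychonoff's theorem for the function type. Iterating it over the arguments yields
  compact sets of kernels and of families of kernels.\<close>

lemma compact_functions_into: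
  fixes K :: "'b::topological_space set"
  assumes "compact K"
  shows "compact {f :: 'a \<Rightarrow> 'b. \<forall>x. f x \<in> K}"
proof -
  have "compactin (product_topology (\<lambda>_::'a. euclidean :: 'b topology) UNIV) (PiE UNIV (\<lambda>_. K))"
    using assms by (subst compactin_PiE) (simp add: compactin_euclidean_iff)
  moreover have "PiE UNIV (\<lambda>_. K) = {f :: 'a \<Rightarrow> 'b. \<forall>x. f x \<in> K}"
    by (auto simp: PiE_def)
  ultimately show ?thesis
    by (simp add: euclidean_product_topology compactin_euclidean_iff)
qed

text \<open>Each condition compares continuous functions of finitely many entries, and the
  quantifiers, including the one over all \<open>v\<close>, only intersect closed sets.\<close>

lemma closed_psd_kernel:
  fixes g :: "'z::topological_space \<Rightarrow> kernel"
  assumes "\<And>i j. continuous_on UNIV (\<lambda>z. g z i j)"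
  shows "closed {z. psd_kernel d (g z)}"
  unfolding psd_kernel_def less_eq_complex_def
  by (intro closed_Collect_conj closed_Collect_all closed_Collect_imp open_Collect_const
      closed_Collect_eq closed_Collect_le continuous_intros assms)

lemma closed_povm_kernel:
  fixes g :: "'z::topological_space \<Rightarrow> 'x::finite \<Rightarrow> kernel"
  assumes "\<And>x i j. continuous_on UNIV (\<lambda>z. g z x i j)"
  shows "closed {z. povm_kernel d (g z)}"
  unfolding povm_kernel_def
  by (intro closed_Collect_conj closed_Collect_all closed_Collect_imp open_Collect_const
      closed_Collect_eq closed_psd_kernel continuous_intros assms)

text \<open>The set is the continuous image of a closed subset of a compact parameter space of
  states and measurements with entries in the unit disc.\<close>

lemma compact_C_q_dim:
  "compact (C_q_dim d :: (real ^ ('a::finite \<times> 'b::finite \<times> 's::finite \<times> 't::finite)) set)"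
proof -
  define K1 where "K1 = {\<psi> :: kernel. \<forall>i. \<psi> i \<in> {g. \<forall>j. g j \<in> cball 0 1}}"
  define K2 where "K2 = {E :: 's \<Rightarrow> 'a \<Rightarrow> kernel. \<forall>s. E s \<in> {g. \<forall>a. g a \<in> K1}}"
  define K3 where "K3 = {F :: 't \<Rightarrow> 'b \<Rightarrow> kernel. \<forall>t. F t \<in> {g. \<forall>b. g b \<in> K1}}"
  have "compact K1"
    unfolding K1_def by (intro compact_functions_into compact_cball)
  then have comp: "compact (K1 \<times> K2 \<times> K3)"
    unfolding K2_def K3_def by (intro compact_Times compact_functions_into)
  \<comment> \<open>Taking real parts makes the map total and continuous; \<open>Z\<close> then
    demands that the imaginary parts vanish.\<close>
  let ?P = "\<lambda>z :: kernel \<times> ('s \<Rightarrow> 'a \<Rightarrow> kernel) \<times> ('t \<Rightarrow> 'b \<Rightarrow> kernel). \<chi> x. Re (case x of (a, b, s, t) \<Rightarrow> born d (fst (snd z) s a) (snd (snd z) t b) (fst z))"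
  define Z where "Z = {z :: kernel \<times> ('s \<Rightarrow> 'a \<Rightarrow> kernel) \<times>
      ('t \<Rightarrow> 'b \<Rightarrow> kernel).
    (\<Sum>i<d. \<Sum>j<d. fst z i j * cnj (fst z i j)) = 1 \<and>
    (\<forall>s. povm_kernel d (fst (snd z) s)) \<and> (\<forall>t. povm_kernel d (snd (snd z) t)) \<and>
    correlation (?P z) \<and>
    (\<forall>a b s t. Im (born d (fst (snd z) s a) (snd (snd z) t b) (fst z)) = 0)}"
  have "continuous_on UNIV (\<lambda>z :: kernel \<times> ('s \<Rightarrow> 'a \<Rightarrow> kernel) \<times> ('t \<Rightarrow> 'b \<Rightarrow> kernel). fst z)"
    "continuous_on UNIV (\<lambda>z :: kernel \<times> ('s \<Rightarrow> 'a \<Rightarrow> kernel) \<times> ('t \<Rightarrow> 'b \<Rightarrow> kernel). fst (snd z))"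
    "continuous_on UNIV (\<lambda>z :: kernel \<times> ('s \<Rightarrow> 'a \<Rightarrow> kernel) \<times> ('t \<Rightarrow> 'b \<Rightarrow> kernel). snd (snd z))"
    by (intro continuous_on_fst continuous_on_snd continuous_on_id)+
  note cont =
    this(1)[THEN continuous_on_product_then_coordinatewise, THEN continuous_on_product_then_coordinatewise]
    this(2,3)[THEN continuous_on_product_then_coordinatewise, THEN continuous_on_product_then_coordinatewise,
      THEN continuous_on_product_then_coordinatewise, THEN continuous_on_product_then_coordinatewise]
  have born: "continuous_on UNIV (\<lambda>z :: kernel \<times> ('s \<Rightarrow> 'a \<Rightarrow> kernel) \<times> ('t \<Rightarrow> 'b \<Rightarrow> kernel). born d (fst (snd z) s a) (snd (snd z) t b) (fst z))" for s a t b
    unfolding born_def by (intro continuous_intros cont)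
  have "closed Z"
    unfolding Z_def correlation_def vec_lambda_beta prod.case
    by (intro closed_Collect_conj closed_Collect_all closed_povm_kernel closed_Collect_eq
        closed_Collect_le continuous_intros cont born)
  with comp have "compact ((K1 \<times> K2 \<times> K3) \<inter> Z)"
    by (rule compact_Int_closed)
  moreover have "continuous_on ((K1 \<times> K2 \<times> K3) \<inter> Z) ?P"
  proof -
    have "continuous_on UNIV ?P"
      by (intro continuous_on_vec_lambda) (auto intro!: continuous_on_Re born split: prod.split)
    then show ?thesis by (rule continuous_on_subset) simp
  qed
  ultimately have "compact (?P ` ((K1 \<times> K2 \<times> K3) \<inter> Z))"
    by (intro compact_continuous_image)
  also have "?P ` ((K1 \<times> K2 \<times> K3) \<inter> Z) = C_q_dim d"
  proof (intro equalityI subsetI)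
    fix P assume "P \<in> ?P ` ((K1 \<times> K2 \<times> K3) \<inter> Z)"
    then obtain \<psi> E F where z: "(\<psi>, E, F) \<in> Z" "P = ?P (\<psi>, E, F)" by auto
    show "P \<in> C_q_dim d"
      unfolding C_q_dim_iff using z
      by (intro conjI exI[of _ \<psi>] exI[of _ E] exI[of _ F]) (auto simp: Z_def complex_eq_iff)
  next
    fix P :: "real ^ ('a \<times> 'b \<times> 's \<times> 't)" assume "P \<in> C_q_dim d"
    then obtain \<psi> and E :: "'s \<Rightarrow> 'a \<Rightarrow> kernel" and F :: "'t \<Rightarrow> 'b \<Rightarrow> kernel"
      where *: "correlation P" "(\<Sum>i<d. \<Sum>j<d. \<psi> i j * cnj (\<psi> i j)) = 1"
        "\<And>s. povm_kernel d (E s)" "\<And>t. povm_kernel d (F t)"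
        "\<And>a b s t. complex_of_real (vec_nth P (a, b, s, t)) = born d (E s a) (F t b) \<psi>"
      unfolding C_q_dim_iff by blast
    \<comment> \<open>Entries at indices from \<open>d\<close> on are unconstrained and may leave
      the unit disc. Setting them to 0 brings the parameters into the compact box and changes no
      form.\<close>
    define cut :: "kernel \<Rightarrow> kernel"
      where "cut M i j = (if i < d \<and> j < d then M i j else 0)" for M i j
    let ?z = "(cut \<psi>, \<lambda>s a. cut (E s a), \<lambda>t b. cut (F t b))"
    have cut: "povm_kernel d (\<lambda>a. cut (E s a))" "povm_kernel d (\<lambda>b. cut (F t b))" for s t
      using *(3)[of s] *(4)[of t] povm_kernel_cong[of d "\<lambda>a. cut (E s a)" "E s"]
        povm_kernel_cong[of d "\<lambda>b. cut (F t b)" "F t"]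
      by (simp_all add: cut_def)
    have born_cut: "born d (cut (E s a)) (cut (F t b)) (cut \<psi>) = complex_of_real (vec_nth P (a, b, s, t))" for a b s t
      unfolding *(5) by (rule born_cong) (simp_all add: cut_def)
    have P: "?P ?z = P"
      by (simp add: vec_eq_iff born_cut split: prod.split)
    have "?z \<in> K1 \<times> K2 \<times> K3"
      using povm_kernel_norm_le_1[OF *(3)] povm_kernel_norm_le_1[OF *(4)] unit_kernel_norm_le_1[OF *(2)]
      by (auto simp: K1_def K2_def K3_def cut_def)
    moreover have "?z \<in> Z"
      using *(1,2) cut P by (simp add: Z_def born_cut) (simp add: cut_def)
    ultimately show "P \<in> ?P ` ((K1 \<times> K2 \<times> K3) \<inter> Z)"
      using P by (intro image_eqI[of _ _ ?z]) auto
  qed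
  finally show ?thesis .
qed

subsection \<open>Average entanglement dimension\<close>

lemma C_q_dim_D_q_le:
  assumes "P \<in> C_q"
  shows "\<exists>d\<le>D_q P. P \<in> C_q_dim d"
proof -
  obtain d where "P \<in> C_q_dim d" using assms by (auto simp: C_q_def)
  then have "D_q P \<in> {d\<^sup>2 | d. P \<in> C_q_dim d}"
    unfolding D_q_def by (intro LeastI) blast
  then obtain e where "D_q P = e\<^sup>2" "P \<in> C_q_dim e" by blast
  \<comment> \<open>Bounding \<open>e\<close> by its square is crude, but still leaves only finitely
    many dimensions below a given value of \<open>D_q\<close>.\<close>
  then show ?thesis
    by (intro exI[of _ e]) (simp add: power2_nat_le_imp_le)
qed

lemma A_q_less_decomposition:
  fixes P :: "real ^ ('a::finite \<times> 'b::finite \<times> 's::finite \<times> 't::finite)"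
  assumes "P \<in> C_q" "A_q P < c"
  shows "\<exists>(n :: nat) (w :: nat \<Rightarrow> real) Q. (\<forall>i<n. 0 \<le> w i) \<and> (\<Sum>i<n. w i) = 1 \<and>
    P = (\<Sum>i<n. w i *\<^sub>R Q i) \<and> (\<forall>i<n. Q i \<in> C_q) \<and> (\<Sum>i<n. w i * real (D_q (Q i))) < c"
proof -
  let ?S = "{(\<Sum>i<n. w i * real (D_q (Q i))) |
    (n :: nat) (w :: nat \<Rightarrow> real) (Q :: nat \<Rightarrow> real ^ ('a \<times> 'b \<times> 's \<times> 't)).
    (\<forall>i<n. 0 \<le> w i) \<and> (\<Sum>i<n. w i) = 1 \<and>
    P = (\<Sum>i<n. w i *\<^sub>R Q i) \<and> (\<forall>i<n. Q i \<in> C_q)}"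
  \<comment> \<open>The trivial decomposition shows that the infimum is over a nonempty set, so a
    value below \<open>c\<close> is attained by some member.\<close>
  have "(\<Sum>i<1::nat. 1 * real (D_q P)) \<in> ?S"
    using assms(1) by (intro CollectI exI[of _ "1::nat"] exI[of _ "\<lambda>_. 1::real"] exI[of _ "\<lambda>_. P"]) auto
  then have "?S \<noteq> {}" by (rule ex_in_conv[THEN iffD1, OF exI])
  moreover have "Inf ?S < c" using assms(2) unfolding A_q_def .
  ultimately have "\<exists>x\<in>?S. x < c" by (rule cInf_lessD)
  then obtain x where x: "x \<in> ?S" "x < c" by (rule bexE)
  from x(1) show ?thesis
  proof (elim CollectE exE conjE)
    fix n :: nat and w :: "nat \<Rightarrow> real" and Q :: "nat \<Rightarrow> real ^ ('a \<times> 'b \<times> 's \<times> 't)"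
    assume "x = (\<Sum>i<n. w i * real (D_q (Q i)))" "\<forall>i<n. 0 \<le> w i" "(\<Sum>i<n. w i) = 1"
      "P = (\<Sum>i<n. w i *\<^sub>R Q i)" "\<forall>i<n. Q i \<in> C_q"
    with x(2) show ?thesis
      by (intro exI[of _ n] exI[of _ w] exI[of _ Q]) simp
  qed
qed

text \<open>Here \<open>r\<close> is the renormalized part of a cheap decomposition lying in
  dimension at most \<open>m\<close>, and \<open>s\<close> is the reflection of \<open>r\<close> in
  \<open>P\<close>. The factor 2 in the hypothesis gives the low-dimensional part more than half of
  the weight, which is what makes the reflected coefficients nonnegative.\<close>

lemma midpoint_decomposition:
  fixes P :: "real ^ ('a::finite \<times> 'b::finite \<times> 's::finite \<times> 't::finite)"
  assumes "P \<in> C_q" "A_q P < c" "2 * c \<le> real m"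
  shows "\<exists>r\<in>convex hull (\<Union>d\<le>m. C_q_dim d). \<exists>s\<in>C_q. P = midpoint r s"
proof -
  obtain n :: nat and w :: "nat \<Rightarrow> real" and Q :: "nat \<Rightarrow> real ^ ('a \<times> 'b \<times> 's \<times> 't)" where
    "\<forall>i<n. 0 \<le> w i" and w_sum: "(\<Sum>i<n. w i) = 1" and P: "P = (\<Sum>i<n. w i *\<^sub>R Q i)"
    and "\<forall>i<n. Q i \<in> C_q" and less: "(\<Sum>i<n. w i * real (D_q (Q i))) < c"
    using A_q_less_decomposition[OF assms(1,2)] by (elim exE conjE) (rule that)
  then have w: "\<And>i. i < n \<Longrightarrow> 0 \<le> w i" and Q: "\<And>i. i < n \<Longrightarrow> Q i \<in> C_q"
    by simp_all
  define J where "J = {i \<in> {..<n}. D_q (Q i) \<le> m}"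
  define \<mu> where "\<mu> = sum w J"
  have J: "J \<subseteq> {..<n}" "finite J" by (auto simp: J_def)
  have split: "sum f {..<n} = sum f J + sum f ({..<n} - J)" for f :: "nat \<Rightarrow> 'c::comm_monoid_add"
    using sum.subset_diff[OF J(1), of f] by (simp add: add.commute)
  \<comment> \<open>Markov's inequality: less than half of the weight lies on terms of large dimension\<close>
  have "(\<Sum>i\<in>{..<n} - J. w i) * real m = (\<Sum>i\<in>{..<n} - J. w i * real m)"
    by (rule sum_distrib_right)
  also have "\<dots> \<le> (\<Sum>i\<in>{..<n} - J. w i * real (D_q (Q i)))"
    using w by (intro sum_mono mult_left_mono) (auto simp: J_def)
  also have "\<dots> \<le> (\<Sum>i<n. w i * real (D_q (Q i)))"
    using w by (intro sum_mono2) auto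
  also have "(\<Sum>i\<in>{..<n} - J. w i) = 1 - \<mu>"
    using split[of w] w_sum by (simp add: \<mu>_def)
  finally have tail: "(1 - \<mu>) * real m < c"
    using less by simp
  \<comment> \<open>Nonnegativity of the average forces \<open>c\<close>, and hence
    \<open>m\<close>, to be positive, so that \<open>m\<close> can be cancelled.\<close>
  have "0 \<le> (\<Sum>i<n. w i * real (D_q (Q i)))"
    using w by (intro sum_nonneg) auto
  with less assms(3) have "0 < real m" by linarith
  moreover have "(1 - \<mu>) * real m < 1/2 * real m"
    using tail assms(3) by linarith
  ultimately have \<mu>: "1/2 < \<mu>"
    using mult_less_cancel_right_pos by fastforce
  define r where "r = (\<Sum>i\<in>J. (w i / \<mu>) *\<^sub>R Q i)"
  have "r \<in> convex hull (\<Union>d\<le>m. C_q_dim d)"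
    unfolding r_def
  proof (rule convex_sum[OF J(2) convex_convex_hull])
    show "(\<Sum>i\<in>J. w i / \<mu>) = 1"
      using \<mu> by (simp add: \<mu>_def flip: sum_divide_distrib)
    fix i assume "i \<in> J"
    then show "0 \<le> w i / \<mu>" using w \<mu> by (auto simp: J_def)
    have "Q i \<in> (\<Union>d\<le>m. C_q_dim d)"
      using \<open>i \<in> J\<close> C_q_dim_D_q_le[OF Q, of i] by (force simp: J_def)
    then show "Q i \<in> convex hull (\<Union>d\<le>m. C_q_dim d)" by (rule hull_inc)
  qed
  \<comment> \<open>The coefficients of \<open>2 *\<^sub>R P - r\<close>. On \<open>J\<close> the
    factor \<open>2 - 1 / \<mu>\<close> is positive because \<open>\<mu>\<close> exceeds 1/2; the
    total is 2 minus the unit weight of \<open>r\<close>.\<close>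
  moreover define x where "x i = (if i \<in> J then (2 - 1 / \<mu>) * w i else 2 * w i)" for i
  have xJ: "(\<Sum>i<n. x i *\<^sub>R Q i) = 2 *\<^sub>R P - r"
  proof -
    have "(\<Sum>i<n. x i *\<^sub>R Q i) =
        (\<Sum>i\<in>J. ((2 - 1 / \<mu>) * w i) *\<^sub>R Q i) + (\<Sum>i\<in>{..<n} - J. (2 * w i) *\<^sub>R Q i)"
      unfolding split[of "\<lambda>i. x i *\<^sub>R Q i"] by (simp add: x_def)
    also have "(\<Sum>i\<in>J. ((2 - 1 / \<mu>) * w i) *\<^sub>R Q i) = 2 *\<^sub>R (\<Sum>i\<in>J. w i *\<^sub>R Q i) - r"
      by (simp add: r_def left_diff_distrib scaleR_diff_left sum_subtractf scaleR_sum_right)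
    also have "(\<Sum>i\<in>{..<n} - J. (2 * w i) *\<^sub>R Q i) = 2 *\<^sub>R (\<Sum>i\<in>{..<n} - J. w i *\<^sub>R Q i)"
      by (simp add: scaleR_sum_right)
    finally show ?thesis
      by (simp add: P split[of "\<lambda>i. w i *\<^sub>R Q i"] scaleR_add_right)
  qed
  have "(\<Sum>i<n. x i *\<^sub>R Q i) \<in> C_q"
  proof (rule convex_sum[OF finite_lessThan convex_C_q])
    have "(\<Sum>i<n. x i) = (\<Sum>i\<in>J. (2 - 1 / \<mu>) * w i) + (\<Sum>i\<in>{..<n} - J. 2 * w i)"
      unfolding split[of x] by (simp add: x_def)
    also have "\<dots> = (2 - 1 / \<mu>) * \<mu> + 2 * (1 - \<mu>)"
      using split[of w] w_sum by (simp add: \<mu>_def flip: sum_distrib_left)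
    also have "\<dots> = 1" using \<mu> by (simp add: field_simps)
    finally show "(\<Sum>i<n. x i) = 1" .
    show "0 \<le> x i" if "i \<in> {..<n}" for i
    proof -
      have "0 \<le> 2 - 1 / \<mu>" using \<mu> by (simp add: field_simps)
      then show ?thesis
        using w[of i] that by (simp add: x_def del: diff_ge_0_iff_ge)
    qed
  qed (use Q in auto)
  moreover have "P = midpoint r (2 *\<^sub>R P - r)"
    by (simp add: midpoint_def)
  ultimately show ?thesis
    unfolding xJ by blast
qed

theorem proposition2p3:
  assumes "\<not> closed (C_q :: (real ^ ('a::finite \<times> 'b::finite \<times> 's::finite \<times> 't::finite)) set)"
  shows "\<exists>P :: nat \<Rightarrow> real ^ ('a \<times> 'b \<times> 's \<times> 't).
    (\<forall>i. P i \<in> C_q) \<and> filterlim (\<lambda>i. A_q (P i)) at_top sequentially"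
proof -
  let ?C = "C_q :: (real ^ ('a \<times> 'b \<times> 's \<times> 't)) set"
  \<comment> \<open>Unboundedness suffices: choosing a point with value at least \<open>n\<close>
    for every \<open>n\<close> gives a divergent sequence.\<close>
  have "\<exists>P\<in>?C. real n \<le> A_q P" for n :: nat
  proof (rule ccontr)
    assume "\<not> (\<exists>P\<in>?C. real n \<le> A_q P)"
    then have bound: "A_q P < real n" if "P \<in> ?C" for P
      using that by force
    \<comment> \<open>The bound \<open>n\<close> on \<open>A_q\<close> makes \<open>2 * n\<close> an
      admissible cutoff dimension, the same for all points of \<open>?C\<close>, so a single compact
      set serves them all.\<close>
    let ?K = "convex hull (\<Union>d\<le>2 * n. C_q_dim d) :: (real ^ ('a \<times> 'b \<times> 's \<times> 't)) set"
    have "compact ?K"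
      by (intro compact_convex_hull compact_UN finite_atMost compact_C_q_dim)
    moreover have "?K \<subseteq> ?C"
      by (rule hull_minimal) (auto simp: C_q_def convex_C_q[unfolded C_q_def])
    moreover have "\<exists>r\<in>?K. \<exists>s\<in>?C. P = midpoint r s" if "P \<in> ?C" for P
      using that bound[OF that] by (rule midpoint_decomposition) simp
    ultimately have "closed ?C"
      by (rule closed_if_midpoints_with_compact[OF convex_C_q bounded_C_q])
    with assms show False by blast
  qed
  then obtain P :: "nat \<Rightarrow> real ^ ('a \<times> 'b \<times> 's \<times> 't)"
    where P: "\<And>n. P n \<in> C_q" "\<And>n. real n \<le> A_q (P n)"
    by metis
  have "filterlim (\<lambda>n. A_q (P n)) at_top sequentially"
    by (rule filterlim_at_top_mono[OF filterlim_real_sequentially]) (simp add: P(2))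
  with P(1) show ?thesis by blast
qed

end
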